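(* Let $n \ge 7$ and let $\mathcal{L}$ be a generic regular $n$-gon linkage. Then $\mathcal{L}$ is hypo-paradoxical: although the Chebyshev–Grübler–Kutzbach count gives $M(\mathcal{L}) = n-6 > 0$, its configuration space has dimension zero, i.e. the linkage admits no nontrivial continuous motion (it is kinematically locked).
   Context: A closed $n$R kinematic chain consists of $n$ revolute joints, joint $i$ having screw axis $\bm{\xi}_i = (\bm{\omega}_i, \bm{q}_i \times \bm{\omega}_i) \in \mathbb{R}^6$, where $\bm{\omega}_i$ is a unit direction vector of the joint axis and $\bm{q}_i$ a point on it, with associated $4\times 4$ twist matrix $\hat{\bm{\xi}}_i = \begin{bmatrix} [\bm{\omega}_i]_\times & \bm{q}_i \times \bm{\omega}_i \\ 0 & 0\end{bmatrix}$. Its configuration space is $\mathcal{C}(\mathcal{L}) = \{(\theta_1,\dots,\theta_n) : \prod_{i=1}^n e^{\hat{\bm{\xi}}_i\theta_i} = I_4\}$, taken near the reference configuration $\theta = 0$ (the mobility depends only on the screw axes, not on the shape of the links). The Chebyshev–Grübler–Kutzbach mobility of a closed chain of $n$ links and $n$ revolute joints is $M = n-6$. A closed chain $\mathcal{L}$ is hypo-paradoxical if $M(\mathcal{L}) > 0$ but $\dim \mathcal{C}(\mathcal{L}) = 0$ (all admissible configurations are isolated). A regular $n$-gon linkage: choose a unit vector $\bm{\omega}_1$ and a point $\bm{q}_1$ in the $xy$-plane, and set $\bm{\omega}_i = R_z(\alpha_i)\bm{\omega}_1$, $\bm{q}_i = R_z(\alpha_i)\bm{q}_1$ with $\alpha_i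 = 2\pi(i-1)/n$, $i=1,\dots,n$, where $R_z$ is rotation about the $z$-axis; the joints $\bm{q}_i$ (vertices of a regular $n$-gon) are connected cyclically by links. It is generic if (i) $\bm{\omega}_1$ is not parallel to the $z$-axis, and (ii) the axes $\bm{\xi}_1,\dots,\bm{\xi}_n$ do not form a pencil of lines through a common point of the $z$-axis. *)

theory Defs
  imports "HOL-Analysis.Analysis" "HOL-Analysis.Cross3"
begin

primrec mpow :: "real^4^4 \<Rightarrow> nat \<Rightarrow> real^4^4" where
  "mpow A 0 = mat 1"
| "mpow A (Suc k) = mpow A k ** A"

definition mexp :: "real^4^4 \<Rightarrow> real^4^4" where
  "mexp A = (\<Sum>k. (1 / fact k) *\<^sub>R mpow A k)"

text \<open>skew-symmetric matrix [w]_x, so that [w]_x v = w cross v\<close>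
definition skew :: "real^3 \<Rightarrow> real^3^3" where
  "skew w = (\<chi> i j. if i = 1 \<and> j = 2 then - (w$3) else if i = 1 \<and> j = 3 then w$2
       else if i = 2 \<and> j = 1 then w$3 else if i = 2 \<and> j = 3 then - (w$1)
       else if i = 3 \<and> j = 1 then - (w$2) else if i = 3 \<and> j = 2 then w$1 else 0)"

definition idx3 :: "4 \<Rightarrow> 3" where
  "idx3 i = (if i = 1 then 1 else if i = 2 then 2 else 3)"

definition block4 :: "real^3^3 \<Rightarrow> real^3 \<Rightarrow> real \<Rightarrow> real^4^4" where
  "block4 B v c = (\<chi> i j. if i = 4 then (if j = 4 then c else 0)
                   else if j = 4 then v $ idx3 i else B $ idx3 i $ idx3 j)"

text \<open>twist matrix hat xi of the revolute joint with axis direction w through point q\<close>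
definition twist :: "real^3 \<Rightarrow> real^3 \<Rightarrow> real^4^4" where
  "twist w q = block4 (skew w) (cross3 q w) 0"

primrec oprod :: "(nat \<Rightarrow> real^4^4) \<Rightarrow> nat \<Rightarrow> real^4^4" where
  "oprod f 0 = mat 1"
| "oprod f (Suc k) = oprod f k ** f (Suc k)"

definition Rz :: "real \<Rightarrow> real^3^3" where
  "Rz a = (\<chi> i j. if i = 1 \<and> j = 1 then cos a else if i = 1 \<and> j = 2 then - sin a
       else if i = 2 \<and> j = 1 then sin a else if i = 2 \<and> j = 2 then cos a
       else if i = 3 \<and> j = 3 then 1 else 0)"

definition ngon_alpha :: "nat \<Rightarrow> nat \<Rightarrow> real" where
  "ngon_alpha n i = 2 * pi * real (i - 1) / real n"

definition ngon_omega :: "nat \<Rightarrow> real^3 \<Rightarrow> nat \<Rightarrow> real^3" where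
  "ngon_omega n w1 i = Rz (ngon_alpha n i) *v w1"

definition ngon_q :: "nat \<Rightarrow> real^3 \<Rightarrow> nat \<Rightarrow> real^3" where
  "ngon_q n q1 i = Rz (ngon_alpha n i) *v q1"

text \<open>configuration space C(L) of the closed nR chain (joint angles indexed 1..n;
  values outside 1..n are irrelevant and fixed to 0)\<close>
definition config_space :: "nat \<Rightarrow> (nat \<Rightarrow> real^3) \<Rightarrow> (nat \<Rightarrow> real^3) \<Rightarrow> (nat \<Rightarrow> real) set" where
  "config_space n w q = {\<theta>. (\<forall>i. i \<notin> {1..n} \<longrightarrow> \<theta> i = 0) \<and>
      oprod (\<lambda>i. mexp (\<theta> i *\<^sub>R twist (w i) (q i))) n = mat 1}"

text \<open>Chebyshev-Gruebler-Kutzbach mobility of a closed chain of n links and n revolute joints\<close>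
definition cgk_mobility :: "nat \<Rightarrow> int" where
  "cgk_mobility n = int n - 6"

text \<open>generic regular n-gon: w1 unit, q1 in the xy-plane, w1 not parallel to the z-axis,
  and the axes are not a pencil of lines through a common point (0,0,c) of the z-axis\<close>
definition generic_ngon :: "nat \<Rightarrow> real^3 \<Rightarrow> real^3 \<Rightarrow> bool" where
  "generic_ngon n w1 q1 \<longleftrightarrow> norm w1 = 1 \<and> q1 $ 3 = 0 \<and>
     cross3 w1 (axis 3 1) \<noteq> 0 \<and>
     \<not> (\<exists>c. \<forall>i\<in>{1..n}. cross3 (vector [0, 0, c] - ngon_q n q1 i) (ngon_omega n w1 i) = 0)"

text \<open>hypo-paradoxical (locally at the reference configuration 0): positive CGK mobility,
  but 0 is an isolated point of the configuration space (dimension zero near 0)\<close>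
definition hypo_paradoxical :: "nat \<Rightarrow> (nat \<Rightarrow> real^3) \<Rightarrow> (nat \<Rightarrow> real^3) \<Rightarrow> bool" where
  "hypo_paradoxical n w q \<longleftrightarrow> cgk_mobility n > 0 \<and>
     (\<exists>\<epsilon>>0. \<forall>\<theta>\<in>config_space n w q. (\<forall>i\<in>{1..n}. \<bar>\<theta> i\<bar> < \<epsilon>) \<longrightarrow> (\<forall>i. \<theta> i = 0))"

end

theory Submission
  imports Defs
begin

text \<open>
  If the reference configuration were not isolated, some sequence of nonzero configurations would
  tend to it, with a limiting direction \<open>u \<noteq> 0\<close>. Expanding the product of exponentials to second
  order, the first order condition reads \<open>\<Sum> u\<^sub>i \<xi>\<^sub>i = 0\<close>; for a generic regular polygon this means
  \<open>\<Sum> u\<^sub>i = 0\<close> and \<open>\<Sum> u\<^sub>i cis \<alpha>\<^sub>i = 0\<close>. The second order condition says that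
  \<open>\<Sum>\<^bsub>i<j\<^esub> u\<^sub>i u\<^sub>j [\<xi>\<^sub>i, \<xi>\<^sub>j]\<close> lies in the span of the twists. A linear form that kills all twists
  \<open>\<xi>\<^sub>i\<close> sends \<open>[\<xi>\<^sub>i, \<xi>\<^sub>j]\<close> to a constant times \<open>sin (\<alpha>\<^sub>j - \<alpha>\<^sub>i)\<close>, and the constant is nonzero exactly
  because the axes form no pencil. So the closed polygon with edges \<open>u\<^sub>i cis \<alpha>\<^sub>i\<close> and vanishing
  signed perimeter has zero signed area. By the discrete Wirtinger (isoperimetric) inequality this
  forces \<open>u = 0\<close>.
\<close>

subsection \<open>Second order expansion of a product of exponentials\<close>

lemma bounded_bilinear_matrix_mult:
  "bounded_bilinear ((**) :: real^'n^'n \<Rightarrow> real^'n^'n \<Rightarrow> real^'n^'n)"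
  unfolding bilinear_conv_bounded_bilinear[symmetric] bilinear_def
  by (intro conjI allI linearI)
     (simp_all add: vec_eq_iff matrix_matrix_mult_def algebra_simps sum.distrib sum_distrib_left)

interpretation matmul: bounded_bilinear "(**) :: real^'n^'n \<Rightarrow> real^'n^'n \<Rightarrow> real^'n^'n"
  by (rule bounded_bilinear_matrix_mult)

section \<open>The exponential series of a twist\<close>

lemma mpow_scaleR: "mpow (x *\<^sub>R A) k = x ^ k *\<^sub>R mpow A k"
  by (induction k) (simp_all add: matmul.scaleR_left matmul.scaleR_right mult.commute)

lemma mpow_even_odd:
  assumes "A ** A ** A = - A"
  shows "mpow A (2 * k + 1) = (-1) ^ k *\<^sub>R A" "mpow A (2 * k + 2) = (-1) ^ k *\<^sub>R (A ** A)"
proof (induction k)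
  case (Suc k)
  have "mpow A (2 * Suc k + 1) = mpow A (2 * k + 2) ** A" by simp
  also have "\<dots> = (-1) ^ Suc k *\<^sub>R A"
    unfolding Suc.IH(2) by (simp add: matmul.scaleR_left assms)
  finally show c1: "mpow A (2 * Suc k + 1) = (-1) ^ Suc k *\<^sub>R A" .
  have "mpow A (2 * Suc k + 2) = mpow A (2 * Suc k + 1) ** A" by simp
  also have "\<dots> = (-1) ^ Suc k *\<^sub>R (A ** A)"
    unfolding c1 by (rule matmul.scaleR_left)
  finally show "mpow A (2 * Suc k + 2) = (-1) ^ Suc k *\<^sub>R (A ** A)" .
qed simp_all

text \<open>Rodrigues' formula: as \<open>A\<close> cubed is \<open>- A\<close>, all odd powers are
  \<open>A\<close> and all positive even powers are \<open>A ** A\<close> up to sign, so the series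
  splits into a sine and a cosine part.\<close>

lemma mexp_rodrigues:
  assumes "A ** A ** A = - A"
  shows "mexp (x *\<^sub>R A) = mat 1 + sin x *\<^sub>R A + (1 - cos x) *\<^sub>R (A ** A)"
proof -
  \<comment> \<open>The indicator of \<open>k = 0\<close> supplies the identity matrix and cancels
    the constant term of the cosine series.\<close>
  define d where "d k = (if k = 0 then 1 else 0 :: real)" for k :: nat
  have d: "d sums 1"
    unfolding d_def using sums_If_finite_set[of "{0::nat}" "\<lambda>_. 1::real"] by simp
  have "(1 / fact k) *\<^sub>R mpow (x *\<^sub>R A) k
      = d k *\<^sub>R mat 1 + (sin_coeff k *\<^sub>R x ^ k) *\<^sub>R A
        + (d k - cos_coeff k *\<^sub>R x ^ k) *\<^sub>R (A ** A)" for k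
  proof (cases "k = 0")
    case True
    then show ?thesis by (simp add: d_def)
  next
    case False
    show ?thesis
    proof (cases "odd k")
      case True
      then obtain l where l: "k = 2 * l + 1" by (elim oddE)
      show ?thesis
        unfolding mpow_scaleR using mpow_even_odd(1)[OF assms, of l] l
        by (simp add: d_def sin_coeff_def cos_coeff_def)
    next
      case ev: False
      with False obtain l where l: "k = 2 * l + 2"
        by (metis add.commute add_2_eq_Suc' dvdE mult_Suc_right not0_implies_Suc mult_0_right)
      show ?thesis
        unfolding mpow_scaleR using mpow_even_odd(2)[OF assms, of l] l
        by (simp add: d_def sin_coeff_def cos_coeff_def)
    qed
  qed
  moreover have "(\<lambda>k. d k *\<^sub>R (mat 1 :: real^4^4) + (sin_coeff k *\<^sub>R x ^ k) *\<^sub>R A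
        + (d k - cos_coeff k *\<^sub>R x ^ k) *\<^sub>R (A ** A))
      sums (1 *\<^sub>R mat 1 + sin x *\<^sub>R A + (1 - cos x) *\<^sub>R (A ** A))"
    by (intro sums_add sums_diff bounded_linear.sums[OF bounded_linear_scaleR_left]
        d sin_converges cos_converges)
  ultimately show ?thesis
    unfolding mexp_def by (simp add: sums_iff)
qed

section \<open>Second order remainders along a sequence\<close>

lemma sin_remainder_tendsto:
  fixes x t :: "nat \<Rightarrow> real"
  assumes "t \<longlonglongrightarrow> 0" "(\<lambda>m. x m / t m) \<longlonglongrightarrow> u" "\<And>m. t m \<noteq> 0"
  shows "(\<lambda>m. (sin (x m) - x m) / (t m)\<^sup>2) \<longlonglongrightarrow> 0"
proof (rule Lim_null_comparison)
  have b: "\<bar>sin y - y\<bar> \<le> \<bar>y\<bar> ^ 3" for y :: real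
  proof -
    have "\<bar>sin y - y\<bar> \<le> inverse (fact 3) * \<bar>y\<bar> ^ 3"
      using Maclaurin_sin_bound[of y 3] by (simp add: eval_nat_numeral sin_coeff_def)
    also have "\<dots> \<le> 1 * \<bar>y\<bar> ^ 3"
      by (intro mult_right_mono) (auto simp: fact_numeral)
    finally show ?thesis by simp
  qed
  show "\<forall>\<^sub>F m in sequentially. norm ((sin (x m) - x m) / (t m)\<^sup>2) \<le> \<bar>x m / t m\<bar> ^ 3 * \<bar>t m\<bar>"
  proof (intro always_eventually allI)
    fix m
    have "norm ((sin (x m) - x m) / (t m)\<^sup>2) \<le> \<bar>x m\<bar> ^ 3 / (t m)\<^sup>2"
      using b[of "x m"] by (simp add: divide_right_mono)
    also have "\<dots> = \<bar>x m / t m\<bar> ^ 3 * \<bar>t m\<bar>"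
      using assms(3)[of m]
      by (simp add: power_divide abs_divide eval_nat_numeral flip: abs_mult)
    finally show "norm ((sin (x m) - x m) / (t m)\<^sup>2) \<le> \<bar>x m / t m\<bar> ^ 3 * \<bar>t m\<bar>" .
  qed
  have "(\<lambda>m. \<bar>x m / t m\<bar> ^ 3 * \<bar>t m\<bar>) \<longlonglongrightarrow> \<bar>u\<bar> ^ 3 * \<bar>0\<bar>"
    by (intro tendsto_intros assms)
  then show "(\<lambda>m. \<bar>x m / t m\<bar> ^ 3 * \<bar>t m\<bar>) \<longlonglongrightarrow> 0" by simp
qed

lemma sin_ratio_tendsto:
  fixes x t :: "nat \<Rightarrow> real"
  assumes "t \<longlonglongrightarrow> 0" "(\<lambda>m. x m / t m) \<longlonglongrightarrow> u" "\<And>m. t m \<noteq> 0"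
  shows "(\<lambda>m. sin (x m) / t m) \<longlonglongrightarrow> u"
proof -
  have "(\<lambda>m. (sin (x m) - x m) / (t m)\<^sup>2 * t m + x m / t m) \<longlonglongrightarrow> 0 * 0 + u"
    by (intro tendsto_intros sin_remainder_tendsto[OF assms] assms)
  moreover have "(sin (x m) - x m) / (t m)\<^sup>2 * t m + x m / t m = sin (x m) / t m" for m
    using assms(3)[of m] by (simp add: field_simps power2_eq_square)
  ultimately show ?thesis by simp
qed

lemma cos_ratio_tendsto:
  fixes x t :: "nat \<Rightarrow> real"
  assumes "t \<longlonglongrightarrow> 0" "(\<lambda>m. x m / t m) \<longlonglongrightarrow> u" "\<And>m. t m \<noteq> 0"
  shows "(\<lambda>m. (1 - cos (x m)) / (t m)\<^sup>2) \<longlonglongrightarrow> u\<^sup>2 / 2"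
proof -
  have "(\<lambda>m. x m / t m / 2) \<longlonglongrightarrow> u / 2"
    by (intro tendsto_intros assms) simp
  then have "(\<lambda>m. sin (x m / 2) / t m) \<longlonglongrightarrow> u / 2"
    by (intro sin_ratio_tendsto assms) (simp add: mult.commute)
  then have "(\<lambda>m. 2 * (sin (x m / 2) / t m)\<^sup>2) \<longlonglongrightarrow> 2 * (u / 2)\<^sup>2"
    by (intro tendsto_mult tendsto_power tendsto_const)
  moreover have "2 * (sin (x m / 2) / t m)\<^sup>2 = (1 - cos (x m)) / (t m)\<^sup>2" for m
    using cos_double_sin[of "x m / 2"] by (simp add: power_divide)
  ultimately show ?thesis by (simp only:) (simp add: power_divide)
qed

lemma mexp_remainder_tendsto:
  assumes "t \<longlonglongrightarrow> 0" "(\<lambda>m. x m / t m) \<longlonglongrightarrow> u" "\<And>m. t m \<noteq> 0"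
    and "A ** A ** A = - A"
  shows "(\<lambda>m. inverse ((t m)\<^sup>2) *\<^sub>R (mexp (x m *\<^sub>R A) - mat 1 - x m *\<^sub>R A))
      \<longlonglongrightarrow> (u\<^sup>2 / 2) *\<^sub>R (A ** A)"
proof -
  have "(\<lambda>m. ((sin (x m) - x m) / (t m)\<^sup>2) *\<^sub>R A + ((1 - cos (x m)) / (t m)\<^sup>2) *\<^sub>R (A ** A))
      \<longlonglongrightarrow> 0 *\<^sub>R A + (u\<^sup>2 / 2) *\<^sub>R (A ** A)"
    by (intro tendsto_add tendsto_scaleR tendsto_const sin_remainder_tendsto[OF assms(1-3)]
        cos_ratio_tendsto[OF assms(1-3)])
  moreover have "inverse ((t m)\<^sup>2) *\<^sub>R (mexp (x m *\<^sub>R A) - mat 1 - x m *\<^sub>R A)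
      = ((sin (x m) - x m) / (t m)\<^sup>2) *\<^sub>R A + ((1 - cos (x m)) / (t m)\<^sup>2) *\<^sub>R (A ** A)" for m
    unfolding mexp_rodrigues[OF assms(4)] divide_inverse mult.commute[of _ "inverse _"] scaleR_scaleR[symmetric]
    by (simp add: scaleR_diff_left scaleR_diff_right scaleR_add_right)
  ultimately show ?thesis by simp
qed

lemma remainder_imp_first_order:
  fixes F G :: "nat \<Rightarrow> 'a::real_normed_vector"
  assumes "t \<longlonglongrightarrow> 0" "\<And>m. t m \<noteq> 0"
    and "(\<lambda>m. inverse ((t m)\<^sup>2) *\<^sub>R (F m - G m)) \<longlonglongrightarrow> r"
    and "(\<lambda>m. inverse (t m) *\<^sub>R G m) \<longlonglongrightarrow> g"
  shows "(\<lambda>m. inverse (t m) *\<^sub>R F m) \<longlonglongrightarrow> g"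
proof -
  have "(\<lambda>m. t m *\<^sub>R (inverse ((t m)\<^sup>2) *\<^sub>R (F m - G m)) + inverse (t m) *\<^sub>R G m) \<longlonglongrightarrow> 0 *\<^sub>R r + g"
    by (intro tendsto_intros assms)
  moreover have "t m *\<^sub>R (inverse ((t m)\<^sup>2) *\<^sub>R (F m - G m)) + inverse (t m) *\<^sub>R G m
      = inverse (t m) *\<^sub>R F m" for m
    using assms(2)[of m] by (simp add: power2_eq_square scaleR_diff_right flip: mult.assoc)
  ultimately show ?thesis by simp
qed

text \<open>The linear term keeps the exact angles \<open>x m i\<close> instead of
  \<open>t m * u i\<close>: convergence of \<open>x m i / t m\<close> gives no control of the angles
  to second order.\<close>

lemma oprod_remainder_tendsto:
  fixes x :: "nat \<Rightarrow> nat \<Rightarrow> real"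
  assumes t: "t \<longlonglongrightarrow> 0" "\<And>m. t m \<noteq> 0"
    and x: "\<And>i. (\<lambda>m. x m i / t m) \<longlonglongrightarrow> u i"
    and cube: "\<And>i. X i ** X i ** X i = - X i"
  shows "(\<lambda>m. inverse ((t m)\<^sup>2) *\<^sub>R
            (oprod (\<lambda>i. mexp (x m i *\<^sub>R X i)) k - mat 1 - (\<Sum>i=1..k. x m i *\<^sub>R X i)))
      \<longlonglongrightarrow> (\<Sum>j=1..k. (\<Sum>i=1..<j. u i *\<^sub>R X i) ** (u j *\<^sub>R X j) + ((u j)\<^sup>2 / 2) *\<^sub>R (X j ** X j))"
proof (induction k)
  case 0
  then show ?case by simp
next
  case (Suc k)
  define P where "P m = oprod (\<lambda>i. mexp (x m i *\<^sub>R X i)) k" for m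
  define L where "L m = (\<Sum>i=1..k. x m i *\<^sub>R X i)" for m
  define E where "E m = mexp (x m (Suc k) *\<^sub>R X (Suc k))" for m
  define Y where "Y m = x m (Suc k) *\<^sub>R X (Suc k)" for m
  let ?B = "\<Sum>j=1..k. (\<Sum>i=1..<j. u i *\<^sub>R X i) ** (u j *\<^sub>R X j) + ((u j)\<^sup>2 / 2) *\<^sub>R (X j ** X j)"
  let ?l = "\<Sum>i=1..k. u i *\<^sub>R X i" and ?y = "u (Suc k) *\<^sub>R X (Suc k)"
  have xlim: "(\<lambda>m. inverse (t m) *\<^sub>R (x m i *\<^sub>R X i)) \<longlonglongrightarrow> u i *\<^sub>R X i" for i
    using tendsto_scaleR[OF x tendsto_const[of "X i"], of i] by (simp add: divide_inverse mult.commute)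
  have L: "(\<lambda>m. inverse (t m) *\<^sub>R L m) \<longlonglongrightarrow> ?l"
    unfolding L_def scaleR_sum_right by (intro tendsto_sum xlim)
  have P2: "(\<lambda>m. inverse ((t m)\<^sup>2) *\<^sub>R (P m - mat 1 - L m)) \<longlonglongrightarrow> ?B"
    unfolding P_def L_def by (rule Suc.IH)
  have E2: "(\<lambda>m. inverse ((t m)\<^sup>2) *\<^sub>R (E m - mat 1 - Y m))
      \<longlonglongrightarrow> ((u (Suc k))\<^sup>2 / 2) *\<^sub>R (X (Suc k) ** X (Suc k))"
    unfolding E_def Y_def by (intro mexp_remainder_tendsto t x cube)
  have E1: "(\<lambda>m. inverse (t m) *\<^sub>R (E m - mat 1)) \<longlonglongrightarrow> ?y"
    by (rule remainder_imp_first_order[OF t E2]) (simp only: Y_def xlim)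
  have "(\<lambda>m. mat 1 + t m *\<^sub>R (inverse (t m) *\<^sub>R (E m - mat 1))) \<longlonglongrightarrow> mat 1 + 0 *\<^sub>R ?y"
    by (intro tendsto_intros t E1)
  then have E0: "E \<longlonglongrightarrow> mat 1"
    using t(2) by (simp add: fun_eq_iff)
  \<comment> \<open>Rests on the splitting P E - 1 - (L + Y) = (P - 1 - L) E + L (E - 1) + (E - 1 -
    Y), divided by the square of \<open>t m\<close>; in the middle product each factor absorbs one
    \<open>t m\<close>.\<close>
  have "(\<lambda>m. (inverse ((t m)\<^sup>2) *\<^sub>R (P m - mat 1 - L m)) ** E m
          + (inverse (t m) *\<^sub>R L m) ** (inverse (t m) *\<^sub>R (E m - mat 1))
          + inverse ((t m)\<^sup>2) *\<^sub>R (E m - mat 1 - Y m))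
      \<longlonglongrightarrow> ?B ** mat 1 + ?l ** ?y + ((u (Suc k))\<^sup>2 / 2) *\<^sub>R (X (Suc k) ** X (Suc k))"
    by (intro tendsto_add matmul.tendsto P2 E0 E1 E2 L)
  moreover have "(inverse ((t m)\<^sup>2) *\<^sub>R (P m - mat 1 - L m)) ** E m
          + (inverse (t m) *\<^sub>R L m) ** (inverse (t m) *\<^sub>R (E m - mat 1))
          + inverse ((t m)\<^sup>2) *\<^sub>R (E m - mat 1 - Y m)
      = inverse ((t m)\<^sup>2) *\<^sub>R (P m ** E m - mat 1 - (L m + Y m))" for m
    by (simp add: matmul.scaleR_left matmul.scaleR_right matmul.diff_left matmul.diff_right
        power2_eq_square scaleR_diff_right scaleR_add_right)
  ultimately show ?case
    by (simp add: P_def L_def E_def Y_def atLeastLessThanSuc_atLeastAtMost add.assoc)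
qed

text \<open>The form \<open>\<phi>\<close> eliminates the uncontrolled second order part of the
  angles: that part lies in the span of the \<open>X i\<close>, where \<open>\<phi>\<close>
  vanishes.\<close>

lemma oprod_identity_imp_limit_conditions:
  fixes x :: "nat \<Rightarrow> nat \<Rightarrow> real"
  assumes t: "t \<longlonglongrightarrow> 0" "\<And>m. t m \<noteq> 0"
    and x: "\<And>i. (\<lambda>m. x m i / t m) \<longlonglongrightarrow> u i"
    and cube: "\<And>i. X i ** X i ** X i = - X i"
    and closed: "\<And>m. oprod (\<lambda>i. mexp (x m i *\<^sub>R X i)) n = mat 1"
    and \<phi>: "linear \<phi>" "\<And>i. \<phi> (X i) = (0::real)"
  shows "(\<Sum>i=1..n. u i *\<^sub>R X i) = 0"
    and "(\<Sum>j=1..n. \<Sum>i=1..<j. u i * u j * \<phi> (X i ** X j - X j ** X i)) = 0"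
proof -
  define B where "B k = (\<Sum>j=1..k. (\<Sum>i=1..<j. u i *\<^sub>R X i) ** (u j *\<^sub>R X j)
                          + ((u j)\<^sup>2 / 2) *\<^sub>R (X j ** X j))" for k
  define L where "L k = (\<Sum>i=1..k. u i *\<^sub>R X i)" for k
  interpret \<phi>: linear \<phi> by fact
  have lim: "(\<lambda>m. inverse ((t m)\<^sup>2) *\<^sub>R (0 - (\<Sum>i=1..n. x m i *\<^sub>R X i))) \<longlonglongrightarrow> B n"
    using oprod_remainder_tendsto[of t x u X n, OF t x cube] by (simp add: closed B_def)
  have xlim: "(\<lambda>m. inverse (t m) *\<^sub>R (x m i *\<^sub>R X i)) \<longlonglongrightarrow> u i *\<^sub>R X i" for i
    using tendsto_scaleR[OF x tendsto_const[of "X i"], of i] by (simp add: divide_inverse mult.commute)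
  \<comment> \<open>Since the product is constantly the identity, the role of \<open>F\<close> is
    played by the zero sequence, which must then share the limit of the linear terms.\<close>
  have "(\<lambda>m. inverse (t m) *\<^sub>R (0::real^4^4)) \<longlonglongrightarrow> (\<Sum>i=1..n. u i *\<^sub>R X i)"
    by (rule remainder_imp_first_order[OF t lim])
       (unfold scaleR_sum_right, intro tendsto_sum xlim)
  then show L0: "(\<Sum>i=1..n. u i *\<^sub>R X i) = 0"
    by (simp add: LIMSEQ_const_iff)
  have "(\<lambda>m. \<phi> (inverse ((t m)\<^sup>2) *\<^sub>R (0 - (\<Sum>i=1..n. x m i *\<^sub>R X i)))) \<longlonglongrightarrow> \<phi> (B n)"
    by (intro bounded_linear.tendsto[OF _ lim]) (simp add: linear_conv_bounded_linear[symmetric] \<phi>)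
  then have B0: "\<phi> (B n) = 0"
    by (simp add: \<phi>.scale \<phi>.neg \<phi>.sum \<phi> LIMSEQ_const_iff)
  \<comment> \<open>Each ordered product is half its anticommutator plus half its commutator; the
    symmetric parts and the squares assemble to the square of \<open>L k\<close>, which vanishes for
    \<open>k = n\<close>.\<close>
  have comm: "2 *\<^sub>R B k = L k ** L k
      + (\<Sum>j=1..k. \<Sum>i=1..<j. (u i * u j) *\<^sub>R (X i ** X j - X j ** X i))" for k
  proof (induction k)
    case 0
    then show ?case by (simp add: B_def L_def)
  next
    case (Suc k)
    let ?y = "u (Suc k) *\<^sub>R X (Suc k)"
    have B: "B (Suc k) = B k + L k ** ?y + ((u (Suc k))\<^sup>2 / 2) *\<^sub>R (X (Suc k) ** X (Suc k))"
      by (simp add: B_def L_def atLeastLessThanSuc_atLeastAtMost)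
    have "(\<Sum>i=1..<Suc k. (u i * u (Suc k)) *\<^sub>R (X i ** X (Suc k) - X (Suc k) ** X i))
        = L k ** ?y - ?y ** L k"
      by (simp add: L_def matmul.sum_left matmul.sum_right sum_subtractf[symmetric]
          matmul.scaleR_left matmul.scaleR_right scaleR_diff_right scaleR_sum_right mult.commute
          atLeastLessThanSuc_atLeastAtMost)
    then have S: "(\<Sum>j=1..Suc k. \<Sum>i=1..<j. (u i * u j) *\<^sub>R (X i ** X j - X j ** X i))
        = (\<Sum>j=1..k. \<Sum>i=1..<j. (u i * u j) *\<^sub>R (X i ** X j - X j ** X i)) + (L k ** ?y - ?y ** L k)"
      by simp
    have LL: "L (Suc k) ** L (Suc k) = L k ** L k + L k ** ?y + ?y ** L k
        + (u (Suc k))\<^sup>2 *\<^sub>R (X (Suc k) ** X (Suc k))"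
      by (simp add: L_def matmul.add_left matmul.add_right matmul.scaleR_left matmul.scaleR_right
          scaleR_add_right power2_eq_square)
    have "2 *\<^sub>R (L k ** ?y) = L k ** ?y + L k ** ?y" by (rule scaleR_2)
    then show ?case
      unfolding S LL B scaleR_add_right Suc.IH by simp
  qed
  have "0 = \<phi> (2 *\<^sub>R B n)" by (simp add: \<phi>.scale B0)
  also have "\<dots> = (\<Sum>j=1..n. \<Sum>i=1..<j. u i * u j * \<phi> (X i ** X j - X j ** X i))"
    unfolding comm by (simp add: L_def L0[simplified] \<phi>.sum \<phi>.scale)
  finally show "(\<Sum>j=1..n. \<Sum>i=1..<j. u i * u j * \<phi> (X i ** X j - X j ** X i)) = 0" by simp
qed

subsection \<open>The signed area of an equiangular polygon\<close>

text \<open>A geometric sum of an \<open>n\<close>-th root of unity, which differs from 1 because a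
  nonzero \<open>d\<close> below \<open>n\<close> in absolute value is no multiple of
  \<open>n\<close>.\<close>

lemma sum_roots_of_unity:
  fixes n :: nat and d :: int
  assumes "n > 0" "\<bar>d\<bar> < int n"
  shows "(\<Sum>k<n. cis (2 * pi * real k * real_of_int d / real n)) = (if d = 0 then of_nat n else 0)"
proof (cases "d = 0")
  case False
  define z where "z = cis (2 * pi * real_of_int d / real n)"
  have z: "cis (2 * pi * real k * real_of_int d / real n) = z ^ k" for k
    unfolding z_def Complex.DeMoivre by (rule arg_cong[where f = cis]) simp
  have zn: "z ^ n = 1"
    unfolding z_def Complex.DeMoivre using assms(1) cis_multiple_2pi[of "real_of_int d"] by simp
  have "z \<noteq> 1"
  proof
    assume "z = 1"
    then have "cos (2 * pi * real_of_int d / real n) = 1"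
      unfolding z_def by (simp add: complex_eq_iff)
    then obtain l :: int where "2 * pi * real_of_int d / real n = of_int l * 2 * pi"
      unfolding cos_one_2pi_int by auto
    then have "real_of_int d = of_int (l * int n)"
      using assms(1) by (simp add: field_simps)
    then have "d = l * int n" by (simp only: of_int_eq_iff)
    with assms(2) False show False
      by (cases "l = 0") (auto simp: abs_mult dest: zdvd_imp_le)
  qed
  then show ?thesis
    unfolding z using geometric_sum[of z n] zn False by simp
qed simp

text \<open>Unnormalised, so Parseval's identity carries the factor \<open>n\<close>.\<close>

definition dft :: "nat \<Rightarrow> (nat \<Rightarrow> real) \<Rightarrow> nat \<Rightarrow> complex" where
  "dft n f k = (\<Sum>j<n. of_real (f j) * cis (- (2 * pi * real k * real j / real n)))"

lemma dft_parseval: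
  assumes "n > 0"
  shows "(\<Sum>k<n. cnj (dft n f k) * dft n g k) = of_real (real n * (\<Sum>j<n. f j * g j))"
proof -
  have "(\<Sum>k<n. cnj (dft n f k) * dft n g k)
     = (\<Sum>k<n. \<Sum>j<n. \<Sum>l<n. of_real (f j * g l) * cis (2 * pi * real k * real_of_int (int j - int l) / real n))"
    unfolding dft_def cnj_sum sum_product
    by (intro sum.cong refl) (simp add: cis_cnj cis_mult diff_divide_distrib right_diff_distrib mult_ac)
  also have "\<dots> = (\<Sum>j<n. \<Sum>l<n. \<Sum>k<n. of_real (f j * g l) * cis (2 * pi * real k * real_of_int (int j - int l) / real n))"
    by (subst sum.swap) (intro sum.cong refl sum.swap)
  also have "\<dots> = (\<Sum>j<n. \<Sum>l<n. of_real (f j * g l) * (if l = j then of_nat n else 0))"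
  proof (intro sum.cong refl)
    fix j l assume "j \<in> {..<n}" "l \<in> {..<n}"
    then show "(\<Sum>k<n. of_real (f j * g l) * cis (2 * pi * real k * real_of_int (int j - int l) / real n))
       = of_real (f j * g l) * (if l = j then of_nat n else 0)"
      unfolding sum_distrib_left[symmetric]
      by (subst sum_roots_of_unity) (use assms in auto)
  qed
  also have "\<dots> = of_real (real n * (\<Sum>j<n. f j * g j))"
    by (simp add: if_distrib sum_distrib_left mult_ac cong: if_cong)
  finally show ?thesis .
qed

text \<open>Replacing \<open>k\<close> by \<open>n - k\<close> if necessary brings the angle into
  the interval from 0 to \<pi>, where the cosine decreases.\<close>

lemma cos_multiple_le:
  assumes "1 \<le> k" "k < n"
  shows "cos (2 * pi * real k / real n) \<le> cos (2 * pi / real n)"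
proof (cases "2 * real k \<le> real n")
  case True
  then show ?thesis using assms
    by (intro cos_monotone_0_pi_le) (auto simp: field_simps)
next
  case False
  have "cos (2 * pi * real k / real n) = cos (2 * pi - 2 * pi * real k / real n)"
    by simp
  also have "2 * pi - 2 * pi * real k / real n = 2 * pi * real (n - k) / real n"
    using assms by (simp add: of_nat_diff field_simps)
  also have "cos \<dots> \<le> cos (2 * pi / real n)"
    using assms False mult_left_mono[of "real k + 1" "real n" pi]
    by (intro cos_monotone_0_pi_le) (auto simp: field_simps of_nat_diff)
  finally show ?thesis .
qed

text \<open>The quadratic form is twice the signed area of the closed polygon with edges
  \<open>u j * cis (\<delta> * j)\<close>. In terms of the support numbers \<open>h\<close> of this polygon the edge lengths are
  \<open>u j * sin \<delta> = h (j + 1) + h (j - 1) - 2 * cos \<delta> * h j\<close>, which diagonalises the form in the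
  Fourier basis; only the constant mode, excluded by \<open>u0\<close>, has a positive eigenvalue.\<close>

lemma area_form_definite:
  fixes u :: "nat \<Rightarrow> real" and n :: nat
  defines "\<delta> \<equiv> 2 * pi / real n"
  assumes n: "n \<ge> 3"
    and u0: "(\<Sum>j<n. u j) = 0"
    and uc: "(\<Sum>j<n. u j * cos (\<delta> * real j)) = 0"
    and us: "(\<Sum>j<n. u j * sin (\<delta> * real j)) = 0"
    and Q: "(\<Sum>j<n. \<Sum>i<j. u i * u j * sin (\<delta> * (real j - real i))) = 0"
    and j: "j < n"
  shows "u j = 0"
proof -
  \<comment> \<open>The origin is the starting vertex of the polygon, and \<open>h j\<close> is the
    signed distance from it to the line of edge \<open>j\<close>. Edges \<open>0\<close> and
    \<open>n - 1\<close> meet there, whence the boundary values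
    \<open>h 0 = h (n - 1) = 0\<close>.\<close>
  define h where "h j = (\<Sum>i<j. u i * sin (\<delta> * (real j - real i)))" for j
  have h0: "h 0 = 0" by (simp add: h_def)
  have n\<delta>: "\<delta> * real n = 2 * pi" using n by (simp add: \<delta>_def)
  have hn: "h n = 0"
  proof -
    have "h n = (\<Sum>i<n. - (u i * sin (\<delta> * real i)))"
      unfolding h_def
      by (intro sum.cong refl) (simp add: right_diff_distrib n\<delta> sin_diff)
    then show ?thesis using us by (simp add: sum_negf)
  qed
  have hn1: "h (n - 1) = 0"
  proof -
    have n1: "real (n - 1) = real n - 1" using n by simp
    have "h (n - 1) = (\<Sum>i<n. u i * sin (\<delta> * (real (n - 1) - real i)))"
      using n by (cases n) (simp_all add: h_def)
    also have "\<dots> = (\<Sum>i<n. - (cos \<delta> * (u i * sin (\<delta> * real i)) + sin \<delta> * (u i * cos (\<delta> * real i))))"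
    proof (intro sum.cong refl)
      fix i
      have "\<delta> * (real (n - 1) - real i) = 2 * pi - (\<delta> * real i + \<delta>)"
        unfolding n1 using n\<delta> by (simp add: algebra_simps)
      then show "u i * sin (\<delta> * (real (n - 1) - real i))
          = - (cos \<delta> * (u i * sin (\<delta> * real i)) + sin \<delta> * (u i * cos (\<delta> * real i)))"
        by (simp only:) (simp add: sin_diff sin_add algebra_simps)
    qed
    finally show ?thesis
      by (simp only: sum_negf sum.distrib sum_distrib_left[symmetric] us uc
          mult_zero_right add_0 minus_zero)
  qed
  \<comment> \<open>For \<open>j = 0\<close> the truncated \<open>j - 1 = 0\<close> is harmless: the cyclic predecessor value \<open>h (n - 1)\<close>
    and \<open>h 0\<close> are both zero.\<close>
  have rec: "u j * sin \<delta> = h (Suc j) + h (j - 1) - 2 * cos \<delta> * h j" for j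
  proof (cases j)
    case 0
    then show ?thesis by (simp add: h_def)
  next
    case (Suc l)
    have a: "h (Suc j) = (\<Sum>i<j. u i * sin (\<delta> * (real (Suc j) - real i))) + u j * sin \<delta>"
      by (simp add: h_def)
    have b: "h (j - 1) = (\<Sum>i<j. u i * sin (\<delta> * (real l - real i)))"
      by (simp add: h_def Suc)
    have "sin (\<delta> * (real (Suc j) - real i)) + sin (\<delta> * (real l - real i))
        = 2 * cos \<delta> * sin (\<delta> * (real j - real i))" for i
    proof -
      have e: "\<delta> * (real (Suc j) - real i) = \<delta> * (real j - real i) + \<delta>"
           "\<delta> * (real l - real i) = \<delta> * (real j - real i) - \<delta>"
        by (simp_all add: Suc algebra_simps)
      show ?thesis unfolding e by (simp add: sin_add sin_diff)
    qed
    then have "u i * sin (\<delta> * (real (Suc j) - real i)) + u i * sin (\<delta> * (real l - real i))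
        = 2 * cos \<delta> * (u i * sin (\<delta> * (real j - real i)))" for i
      by (metis (no_types, lifting) distrib_left mult.left_commute)
    then have "(\<Sum>i<j. u i * sin (\<delta> * (real (Suc j) - real i))) + (\<Sum>i<j. u i * sin (\<delta> * (real l - real i)))
        = 2 * cos \<delta> * (\<Sum>i<j. u i * sin (\<delta> * (real j - real i)))"
      by (simp only: sum.distrib[symmetric] sum_distrib_left)
    then show ?thesis
      unfolding a b h_def[of j] by linarith
  qed
  let ?ev = "\<lambda>k. 2 * cos (\<delta> * real k) - 2 * cos \<delta>"
  \<comment> \<open>Shifting \<open>h\<close> by one index multiplies its transform by
    \<open>cnj (\<psi> 1)\<close> or \<open>\<psi> 1\<close>, and these add up to
    \<open>2 * cos (\<delta> * real k)\<close>. The zero boundary values make the shifts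
    cyclic.\<close>
  have hat: "of_real (sin \<delta>) * dft n u k = of_real (?ev k) * dft n h k" for k
  proof -
    define \<psi> where "\<psi> j = cis (- (2 * pi * real k * real j / real n))" for j
    have \<psi>S: "\<psi> (Suc j) = \<psi> j * \<psi> 1" for j
      by (simp add: \<psi>_def cis_mult algebra_simps add_divide_distrib)
    have \<psi>1: "cnj (\<psi> 1) * \<psi> 1 = 1"
      by (simp add: \<psi>_def cis_cnj cis_mult)
    have \<psi>c: "cnj (\<psi> 1) + \<psi> 1 = of_real (2 * cos (\<delta> * real k))"
      by (simp add: \<psi>_def \<delta>_def complex_eq_iff mult_ac)
    have D: "dft n f k = (\<Sum>j<n. of_real (f j) * \<psi> j)" for f
      by (simp add: dft_def \<psi>_def)
    obtain p where p: "n = Suc p" using n by (cases n) auto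
    have \<psi>: "\<psi> j = cnj (\<psi> 1) * \<psi> (Suc j)" for j
      unfolding \<psi>S using \<psi>1 by algebra
    have "(\<Sum>j<n. of_real (h (Suc j)) * \<psi> j) = cnj (\<psi> 1) * (\<Sum>j<n. of_real (h (Suc j)) * \<psi> (Suc j))"
      unfolding sum_distrib_left
      by (intro sum.cong refl) (metis \<psi> mult.left_commute)
    also have "(\<Sum>j<n. of_real (h (Suc j)) * \<psi> (Suc j)) = dft n h k"
      using sum.lessThan_Suc_shift[of "\<lambda>j. of_real (h j) * \<psi> j" n] hn h0 by (simp add: D)
    finally have s1: "(\<Sum>j<n. of_real (h (Suc j)) * \<psi> j) = cnj (\<psi> 1) * dft n h k" .
    have "(\<Sum>j<n. of_real (h (j - 1)) * \<psi> j) = (\<Sum>j<p. of_real (h j) * \<psi> (Suc j))"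
      unfolding p sum.lessThan_Suc_shift using h0 by simp
    also have "\<dots> = \<psi> 1 * (\<Sum>j<p. of_real (h j) * \<psi> j)"
      unfolding sum_distrib_left
      by (intro sum.cong refl) (metis \<psi>S mult.commute mult.left_commute)
    also have "(\<Sum>j<p. of_real (h j) * \<psi> j) = dft n h k"
      unfolding D using hn1 by (simp add: p)
    finally have s2: "(\<Sum>j<n. of_real (h (j - 1)) * \<psi> j) = \<psi> 1 * dft n h k" .
    have "of_real (sin \<delta>) * dft n u k = (\<Sum>j<n. of_real (u j * sin \<delta>) * \<psi> j)"
      unfolding D sum_distrib_left by (intro sum.cong refl) simp
    also have "\<dots> = (\<Sum>j<n. of_real (h (Suc j)) * \<psi> j) + (\<Sum>j<n. of_real (h (j - 1)) * \<psi> j)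
        - of_real (2 * cos \<delta>) * dft n h k"
      unfolding D sum_distrib_left sum.distrib[symmetric] sum_subtractf[symmetric] rec
      by (intro sum.cong refl) (simp add: algebra_simps)
    also have "\<dots> = of_real (?ev k) * dft n h k"
      unfolding s1 s2 of_real_diff \<psi>c[symmetric] by (simp add: algebra_simps)
    finally show ?thesis .
  qed
  have \<delta>: "0 < \<delta>" "\<delta> < pi" using n by (auto simp: \<delta>_def field_simps)
  have s: "sin \<delta> > 0" using \<delta> by (rule sin_gt_zero)
  have c1: "cos \<delta> < 1"
    using cos_monotone_0_pi[of 0 \<delta>] \<delta> by simp
  have hat0: "dft n h 0 = 0"
  proof -
    have "dft n u 0 = 0" using u0 by (simp add: dft_def flip: of_real_sum)
    then show ?thesis using hat[of 0] c1
      by (simp add: complex_eq_iff)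
  qed
  have neg: "?ev k * (cmod (dft n h k))\<^sup>2 \<le> 0" if "k < n" for k
  proof (cases "k = 0")
    case False
    then have "?ev k \<le> 0" using cos_multiple_le[of k n] that by (simp add: \<delta>_def)
    then show ?thesis by (intro mult_nonpos_nonneg) auto
  qed (simp add: hat0)
  \<comment> \<open>Parseval turns the area form into a sum of terms that are all nonpositive, so
    \<open>Q\<close> forces every term to vanish.\<close>
  have "complex_of_real (\<Sum>k<n. ?ev k * (cmod (dft n h k))\<^sup>2)
      = (\<Sum>k<n. cnj (of_real (sin \<delta>) * dft n u k) * dft n h k)"
    unfolding hat of_real_sum of_real_mult complex_norm_square by (simp add: mult_ac)
  also have "\<dots> = of_real (sin \<delta>) * (\<Sum>k<n. cnj (dft n u k) * dft n h k)"
    by (simp add: sum_distrib_left mult_ac)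
  also have "\<dots> = of_real (sin \<delta> * (real n * (\<Sum>j<n. u j * h j)))"
    using dft_parseval[of n u h] n by simp
  also have "(\<Sum>j<n. u j * h j) = 0"
    using Q by (simp add: h_def sum_distrib_left mult_ac)
  finally have "(\<Sum>k<n. ?ev k * (cmod (dft n h k))\<^sup>2) = 0"
    by (simp only: of_real_eq_iff mult_zero_right)
  then have ev0: "?ev k * (cmod (dft n h k))\<^sup>2 = 0" if "k < n" for k
    using that neg sum_nonneg_eq_0_iff[of "{..<n}" "\<lambda>k. - (?ev k * (cmod (dft n h k))\<^sup>2)"]
    by (auto simp: sum_negf simp del: mult_eq_0_iff)
  \<comment> \<open>For \<open>k = 1\<close> and \<open>k = n - 1\<close> the eigenvalue is zero and
    \<open>dft n h k\<close> may survive, reflecting translations of the polygon; by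
    \<open>hat\<close> the transform of \<open>u\<close> vanishes in either case.\<close>
  have "dft n u k = 0" if "k < n" for k
    using ev0[OF that] hat[of k] s by auto
  then have "real n * (\<Sum>j<n. u j * u j) = 0"
    using dft_parseval[of n u u] n by (simp flip: of_real_sum of_real_mult)
  then have "(\<Sum>j<n. u j * u j) = 0" using n by simp
  then show ?thesis using j
    by (simp add: sum_nonneg_eq_0_iff)
qed

subsection \<open>Twists of the regular polygon linkage\<close>

lemma idx3_simps: "idx3 1 = 1" "idx3 2 = 2" "idx3 3 = 3"
  by (simp_all add: idx3_def)

text \<open>The skew block satisfies the identity for a unit \<open>w\<close>. The translation
  column does too, because \<open>cross3 q w\<close> is orthogonal to \<open>w\<close> (zero
  pitch).\<close>

lemma twist_cube:
  assumes "norm w = 1"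
  shows "twist w q ** twist w q ** twist w q = - twist w q"
proof -
  have "w$1 * w$1 + w$2 * w$2 + w$3 * w$3 = 1"
    using assms by (simp add: norm_eq_1 inner_vec_def sum_3)
  then show ?thesis
    unfolding vec_eq_iff forall_4
    by (simp add: matrix_matrix_mult_def sum_4 twist_def block4_def skew_def idx3_simps cross3_def,
        intro conjI; algebra)
qed

section \<open>Rotated twists and their commutators\<close>

lemma Rz_mult_nth:
  "(Rz a *v w) $ 1 = cos a * w$1 - sin a * w$2"
  "(Rz a *v w) $ 2 = sin a * w$1 + cos a * w$2"
  "(Rz a *v w) $ 3 = w$3"
  by (simp_all add: Rz_def matrix_vector_mult_def sum_3)

lemma norm_Rz_mult: "norm (Rz a *v w) = norm w"
proof -
  have "(cos a * w$1 - sin a * w$2)\<^sup>2 + (sin a * w$1 + cos a * w$2)\<^sup>2 = (w$1)\<^sup>2 + (w$2)\<^sup>2"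
    using sin_cos_squared_add[of a] by algebra
  then show ?thesis
    by (simp add: norm_eq_sqrt_inner inner_vec_def sum_3 Rz_mult_nth power2_eq_square)
qed

text \<open>Entries (2,1) and (3,4), the rotation and translation along the z-axis, do not depend on
  \<open>a\<close>; entries (1,3) and (2,3) carry the horizontal axis direction.\<close>

lemma rotated_twist_nth:
  "twist (Rz a *v w) (Rz a *v q) $ 1 $ 3 = sin a * w$1 + cos a * w$2"
  "twist (Rz a *v w) (Rz a *v q) $ 2 $ 3 = sin a * w$2 - cos a * w$1"
  "twist (Rz a *v w) (Rz a *v q) $ 2 $ 1 = w$3"
  "twist (Rz a *v w) (Rz a *v q) $ 3 $ 4 = q$1 * w$2 - q$2 * w$1"
proof -
  have "(cos a * q$1 - sin a * q$2) * (sin a * w$1 + cos a * w$2)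
      - (sin a * q$1 + cos a * q$2) * (cos a * w$1 - sin a * w$2) = q$1 * w$2 - q$2 * w$1"
    using sin_cos_squared_add[of a] by algebra
  then show "twist (Rz a *v w) (Rz a *v q) $ 3 $ 4 = q$1 * w$2 - q$2 * w$1"
    by (simp add: twist_def block4_def skew_def idx3_simps cross3_def Rz_mult_nth)
qed (simp_all add: twist_def block4_def skew_def idx3_simps cross3_def Rz_mult_nth)

text \<open>The rotational and the translational part of a twist along the \<open>z\<close>-axis, combined so
  that all joint twists of the linkage are annihilated.\<close>

definition axial_form :: "real^3 \<Rightarrow> real^3 \<Rightarrow> real^4^4 \<Rightarrow> real" where
  "axial_form w q M = (q$1 * w$2 - q$2 * w$1) * M $ 2 $ 1 - w$3 * M $ 3 $ 4"

lemma linear_axial_form: "linear (axial_form w q)"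
  by (rule linearI) (simp_all add: axial_form_def algebra_simps)

lemma axial_form_rotated_twist: "axial_form w q (twist (Rz a *v w) (Rz a *v q)) = 0"
  by (simp add: axial_form_def rotated_twist_nth)

text \<open>Only horizontal components enter. The rotational part is the z-component of the cross
  product of the directions. The translational part is twice the sine times the inner product of
  horizontal direction and horizontal moment, the latter being \<open>w$3\<close> times
  (\<open>q$2\<close>, \<open>- q$1\<close>) as \<open>q $ 3 = 0\<close>.\<close>

lemma axial_form_commutator:
  fixes w q :: "real^3" and a b :: real
  defines "X \<equiv> twist (Rz a *v w) (Rz a *v q)" and "Y \<equiv> twist (Rz b *v w) (Rz b *v q)"
  assumes "q $ 3 = 0"
  shows "axial_form w q (X ** Y - Y ** X)
    = (q$1 * w$2 - q$2 * w$1) * ((w$1)\<^sup>2 + (w$2)\<^sup>2 + 2 * (w$3)\<^sup>2) * sin (b - a)"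
  unfolding axial_form_def X_def Y_def
  by (simp add: matrix_matrix_mult_def sum_4 twist_def block4_def skew_def idx3_simps
      cross3_def Rz_mult_nth assms(3) sin_diff) (simp add: algebra_simps power2_eq_square)

text \<open>A non-vertical axis with zero moment about the z-axis meets the z-axis, and by
  rotational symmetry all axes then pass through the same point, a pencil.\<close>

lemma generic_ngon_axis_moment_nonzero:
  assumes "generic_ngon n w q"
  shows "q$1 * w$2 - q$2 * w$1 \<noteq> 0" and "(w$1)\<^sup>2 + (w$2)\<^sup>2 > 0"
proof -
  have q3: "q$3 = 0" and w: "cross3 w (axis 3 1) \<noteq> 0"
    and np: "\<And>c. \<exists>i\<in>{1..n}. cross3 (vector [0, 0, c] - ngon_q n q i) (ngon_omega n w i) \<noteq> 0"
    using assms by (auto simp: generic_ngon_def)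
  have w12: "w$1 \<noteq> 0 \<or> w$2 \<noteq> 0"
    using w by (auto simp: cross3_def vec_eq_iff forall_3 axis_def)
  then show "(w$1)\<^sup>2 + (w$2)\<^sup>2 > 0" by (simp add: sum_power2_gt_zero_iff)
  show "q$1 * w$2 - q$2 * w$1 \<noteq> 0"
  proof
    assume v: "q$1 * w$2 - q$2 * w$1 = 0"
    obtain s where s: "q$1 = s * w$1" "q$2 = s * w$2"
    proof (cases "w$1 = 0")
      case True
      then show ?thesis using that[of "q$2 / w$2"] v w12 by auto
    next
      case False
      then show ?thesis using that[of "q$1 / w$1"] v by (simp add: field_simps)
    qed
    \<comment> \<open>The point is \<open>q - s *\<^sub>R w\<close>, which lies on the first axis
      and is fixed by every \<open>Rz\<close>.\<close>
    obtain i where "cross3 (vector [0, 0, - (s * w$3)] - ngon_q n q i) (ngon_omega n w i) \<noteq> 0"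
      using np by blast
    then show False
      by (simp add: cross3_def vec_eq_iff forall_3 ngon_q_def ngon_omega_def Rz_mult_nth s q3 algebra_simps)
  qed
qed

subsection \<open>Limiting directions\<close>

lemma finite_convergent_subsequence:
  fixes f :: "nat \<Rightarrow> 'i \<Rightarrow> real"
  assumes "finite I" "\<And>m i. i \<in> I \<Longrightarrow> \<bar>f m i\<bar> \<le> c"
  shows "\<exists>r l. strict_mono (r :: nat \<Rightarrow> nat) \<and> (\<forall>i\<in>I. (\<lambda>m. f (r m) i) \<longlonglongrightarrow> l i)"
  using assms
proof (induction I rule: finite_induct)
  case empty
  show ?case by (rule exI[of _ id]) (simp add: strict_mono_def)
next
  case (insert j I)
  then obtain r l where r: "strict_mono (r :: nat \<Rightarrow> nat)"
    and l: "\<And>i. i \<in> I \<Longrightarrow> (\<lambda>m. f (r m) i) \<longlonglongrightarrow> l i" by blast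
  have "bounded (range (\<lambda>m. f (r m) j))"
    using insert.prems by (intro boundedI[of _ c]) auto
  then obtain lj s where s: "strict_mono (s :: nat \<Rightarrow> nat)" and lj: "((\<lambda>m. f (r m) j) \<circ> s) \<longlonglongrightarrow> lj"
    using bounded_imp_convergent_subsequence by blast
  have "(\<lambda>m. f ((r \<circ> s) m) i) \<longlonglongrightarrow> (l(j := lj)) i" if "i \<in> insert j I" for i
  proof (cases "i = j")
    case True
    then show ?thesis using lj by (simp add: o_def)
  next
    case False
    then show ?thesis using that LIMSEQ_subseq_LIMSEQ[OF l s] by (simp add: o_def)
  qed
  moreover have "strict_mono (r \<circ> s)" using r s by (rule strict_mono_o)
  ultimately show ?case by blast
qed

text \<open>Dividing by the sum of absolute values puts the configurations on a compact unit sphere;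
  the limit keeps norm 1 and so is nonzero.\<close>

lemma normalized_limit_direction:
  fixes x :: "nat \<Rightarrow> nat \<Rightarrow> real"
  assumes "\<And>i. i \<in> {1..n} \<Longrightarrow> (\<lambda>m. x m i) \<longlonglongrightarrow> 0"
    and "\<And>m i. i \<notin> {1..n} \<Longrightarrow> x m i = 0" and "\<And>m. \<exists>i. x m i \<noteq> 0"
  obtains t and r :: "nat \<Rightarrow> nat" and u
  where "t \<longlonglongrightarrow> 0" "\<forall>m. t m \<noteq> 0" "\<forall>i. (\<lambda>m. x (r m) i / t m) \<longlonglongrightarrow> u i"
    and "\<exists>i\<in>{1..n}. u i \<noteq> 0"
proof -
  define T where "T m = (\<Sum>i=1..n. \<bar>x m i\<bar>)" for m
  have T: "T m \<noteq> 0" for m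
    using assms(2,3) unfolding T_def by (subst sum_nonneg_eq_0_iff) fastforce+
  have b: "\<bar>x m i / T m\<bar> \<le> 1" if "i \<in> {1..n}" for m i
  proof -
    have "\<bar>x m i\<bar> \<le> T m"
      unfolding T_def using that by (intro member_le_sum) auto
    then show ?thesis using T[of m] by (auto simp: divide_le_eq)
  qed
  obtain r l where r: "strict_mono (r :: nat \<Rightarrow> nat)"
    and l: "\<And>i. i \<in> {1..n} \<Longrightarrow> (\<lambda>m. x (r m) i / T (r m)) \<longlonglongrightarrow> l i"
    using finite_convergent_subsequence[of "{1..n}" "\<lambda>m i. x m i / T m" 1] b
    by (metis finite_atLeastAtMost)
  define u where "u i = (if i \<in> {1..n} then l i else 0)" for i
  have u: "(\<lambda>m. x (r m) i / T (r m)) \<longlonglongrightarrow> u i" for i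
    using l assms(2) by (cases "i \<in> {1..n}") (auto simp: u_def)
  have "T \<longlonglongrightarrow> (\<Sum>i=1..n. \<bar>0\<bar>)"
    unfolding T_def by (intro tendsto_sum tendsto_rabs assms)
  then have Tr: "(\<lambda>m. T (r m)) \<longlonglongrightarrow> 0"
    using LIMSEQ_subseq_LIMSEQ[OF _ r, of T] by (simp add: o_def)
  have "(\<lambda>m. \<Sum>i=1..n. \<bar>x (r m) i / T (r m)\<bar>) \<longlonglongrightarrow> (\<Sum>i=1..n. \<bar>u i\<bar>)"
    by (intro tendsto_sum tendsto_rabs u)
  moreover have "(\<Sum>i=1..n. \<bar>x m i / T m\<bar>) = 1" for m
  proof -
    have "0 \<le> T m" unfolding T_def by (intro sum_nonneg) auto
    then have "(\<Sum>i=1..n. \<bar>x m i / T m\<bar>) = T m / T m"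
      by (simp add: abs_divide T_def flip: sum_divide_distrib)
    then show ?thesis using T[of m] by simp
  qed
  ultimately have "(\<Sum>i=1..n. \<bar>u i\<bar>) = 1" by (simp add: LIMSEQ_const_iff)
  then have "\<exists>i\<in>{1..n}. u i \<noteq> 0"
    by (metis abs_zero sum.neutral zero_neq_one)
  with that Tr T u show ?thesis by blast
qed

section \<open>Contradiction from a limiting direction\<close>

theorem mainTheorem1:
  fixes n :: nat and w1 q1 :: "real^3"
  assumes "n \<ge> 7" and "generic_ngon n w1 q1"
  shows "hypo_paradoxical n (ngon_omega n w1) (ngon_q n q1)"
proof (rule ccontr)
  let ?a = "ngon_alpha n"
  define X where "X i = twist (ngon_omega n w1 i) (ngon_q n q1 i)" for i
  have X: "X i = twist (Rz (?a i) *v w1) (Rz (?a i) *v q1)" for i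
    by (simp add: X_def ngon_omega_def ngon_q_def)
  have w1: "norm w1 = 1" and q3: "q1 $ 3 = 0"
    using assms(2) by (auto simp: generic_ngon_def)
  note nz = generic_ngon_axis_moment_nonzero[OF assms(2)]
  assume "\<not> hypo_paradoxical n (ngon_omega n w1) (ngon_q n q1)"
  moreover have "cgk_mobility n > 0"
    using assms(1) by (simp add: cgk_mobility_def)
  ultimately have flexible: "\<exists>\<theta>\<in>config_space n (ngon_omega n w1) (ngon_q n q1).
      (\<forall>i\<in>{1..n}. \<bar>\<theta> i\<bar> < \<epsilon>) \<and> (\<exists>i. \<theta> i \<noteq> 0)" if "\<epsilon> > 0" for \<epsilon>
    using that unfolding hypo_paradoxical_def by blast
  have "\<exists>\<theta>\<in>config_space n (ngon_omega n w1) (ngon_q n q1).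
      (\<forall>i\<in>{1..n}. \<bar>\<theta> i\<bar> < inverse (real (Suc m))) \<and> (\<exists>i. \<theta> i \<noteq> 0)" for m
    by (rule flexible) simp
  then obtain x where x: "\<And>m. x m \<in> config_space n (ngon_omega n w1) (ngon_q n q1)"
    and small: "\<And>m i. i \<in> {1..n} \<Longrightarrow> \<bar>x m i\<bar> < inverse (real (Suc m))"
    and nonzero: "\<And>m. \<exists>i. x m i \<noteq> 0"
    by metis
  have x0: "(\<lambda>m. x m i) \<longlonglongrightarrow> 0" if "i \<in> {1..n}" for i
    using small[OF that]
    by (intro Lim_null_comparison[OF _ LIMSEQ_inverse_real_of_nat]) (auto intro!: always_eventually less_imp_le)
  have xout: "x m i = 0" if "i \<notin> {1..n}" for m i
    using x that by (auto simp: config_space_def)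
  obtain t and r :: "nat \<Rightarrow> nat" and u where "t \<longlonglongrightarrow> 0" "\<forall>m. t m \<noteq> 0"
    and "\<forall>i. (\<lambda>m. x (r m) i / t m) \<longlonglongrightarrow> u i" and unz: "\<exists>i\<in>{1..n}. u i \<noteq> 0"
    by (rule normalized_limit_direction[of n x, OF x0 xout nonzero])
  then have t: "t \<longlonglongrightarrow> 0" "\<And>m. t m \<noteq> 0" and u: "\<And>i. (\<lambda>m. x (r m) i / t m) \<longlonglongrightarrow> u i"
    by blast+
  have cube: "X i ** X i ** X i = - X i" for i
    unfolding X by (rule twist_cube) (simp add: norm_Rz_mult w1)
  have closed: "oprod (\<lambda>i. mexp (x (r m) i *\<^sub>R X i)) n = mat 1" for m
    using x[of "r m"] by (simp add: config_space_def X_def)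
  have \<phi>X: "axial_form w1 q1 (X i) = 0" for i
    unfolding X by (rule axial_form_rotated_twist)
  note lims = oprod_identity_imp_limit_conditions[of t "\<lambda>m. x (r m)" u X,
      OF t u cube closed linear_axial_form \<phi>X]
  have entry: "(\<Sum>i=1..n. u i * X i $ k $ l) = 0" for k l
    using arg_cong[OF lims(1), of "\<lambda>M. M $ k $ l"] by simp
  \<comment> \<open>Entry (3,4) is the same nonzero moment for every joint and can be divided
    out.\<close>
  have u0: "(\<Sum>i=1..n. u i) = 0"
    using entry[of 3 4] nz(1) by (simp add: X rotated_twist_nth flip: sum_distrib_right)
  define C where "C = (\<Sum>i=1..n. u i * cos (?a i))"
  define S where "S = (\<Sum>i=1..n. u i * sin (?a i))"
  have e1: "S * w1$1 + C * w1$2 = 0"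
    using entry[of 1 3]
    by (simp add: X rotated_twist_nth C_def S_def sum_distrib_right sum.distrib distrib_left mult.assoc)
  have e2: "S * w1$2 - C * w1$1 = 0"
    using entry[of 2 3]
    by (simp add: X rotated_twist_nth C_def S_def sum_distrib_right sum_subtractf right_diff_distrib mult.assoc)
  \<comment> \<open>The linear system \<open>e1\<close>, \<open>e2\<close> in \<open>S\<close> and
    \<open>C\<close> has determinant of absolute value
    \<open>(w1$1)\<^sup>2 + (w1$2)\<^sup>2\<close>.\<close>
  have "C * ((w1$1)\<^sup>2 + (w1$2)\<^sup>2) = 0" "S * ((w1$1)\<^sup>2 + (w1$2)\<^sup>2) = 0"
    using e1 e2 by algebra+
  then have CS: "C = 0" "S = 0" using nz(2) by auto
  define \<kappa> where "\<kappa> = (q1$1 * w1$2 - q1$2 * w1$1) * ((w1$1)\<^sup>2 + (w1$2)\<^sup>2 + 2 * (w1$3)\<^sup>2)"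
  have "(w1$1)\<^sup>2 + (w1$2)\<^sup>2 + 2 * (w1$3)\<^sup>2 > 0"
    by (intro add_pos_nonneg nz(2)) simp
  then have \<kappa>: "\<kappa> \<noteq> 0" using nz(1) by (simp add: \<kappa>_def)
  have "\<kappa> * (\<Sum>j=1..n. \<Sum>i=1..<j. u i * u j * sin (?a j - ?a i)) = 0"
    using lims(2) unfolding X axial_form_commutator[OF q3] \<kappa>_def[symmetric]
    by (simp add: sum_distrib_left mult_ac)
  then have Q: "(\<Sum>j=1..n. \<Sum>i=1..<j. u i * u j * sin (?a j - ?a i)) = 0"
    using \<kappa> by simp
  have shift: "(\<Sum>i=1..<Suc k. f i) = (\<Sum>i<k. f (Suc i))" for k and f :: "nat \<Rightarrow> real"
    using sum.shift_bounds_Suc_ivl[of f 0 k] by (simp add: lessThan_atLeast0)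
  have shift': "(\<Sum>i=1..n. f i) = (\<Sum>i<n. f (Suc i))" for f :: "nat \<Rightarrow> real"
    using shift[of f n] by (simp add: atLeastLessThanSuc_atLeastAtMost)
  \<comment> \<open>Joints count from 1 and polygon edges from 0, so the shift removes the
    \<open>i - 1\<close> in the joint angles.\<close>
  have a: "?a (Suc i) = 2 * pi / real n * real i" for i
    by (simp add: ngon_alpha_def)
  have "u (Suc j) = 0" if "j < n" for j
  proof (rule area_form_definite[of n "\<lambda>j. u (Suc j)"])
    show "(\<Sum>j<n. \<Sum>i<j. u (Suc i) * u (Suc j) * sin (2 * pi / real n * (real j - real i))) = 0"
      using Q unfolding shift' shift a right_diff_distrib .
  qed (use assms(1) that u0[unfolded shift'] CS[unfolded C_def S_def shift' a] in simp_all)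
  moreover obtain i where "i \<in> {1..n}" "u i \<noteq> 0" using unz by blast
  ultimately show False by (cases i) auto
qed

end
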